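(* Suppose $g\colon\mathbb{R}^{2}\to\mathbb{R}$ satisfies $$g(x+y,z)+g(x-y,z)+2g(x,y)=g(x,y+z)+g(x,y-z)+2g(y,z)\qquad\text{for all }x,y,z\in\mathbb{R},$$ and that $g$ belongs to one of the following regularity classes: $C^{k}(\mathbb{R}^{2})$ (with $k\ge 2$), $C^{\infty}(\mathbb{R}^{2})$, or the class of real polynomials in two variables. Then the function $f\colon\mathbb{R}\to\mathbb{R}$ defined by $$f(x)=-\tfrac12\,g(0,0)-\tfrac12\,(\partial_{2}g)(0,0)\,x+\tfrac12\int_{0}^{x}(x-t)\,(\partial_{2}^{2}g)(t,0)\,\mathrm{d}t$$ belongs to the corresponding class $C^{k}(\mathbb{R})$, $C^{\infty}(\mathbb{R})$, or the class of real polynomials in one variable, respectively.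
   Context: The symbol $\partial_2$ denotes partial differentiation with respect to the second variable. In the first class, $k$ is an integer. *)

theory Defs
  imports "HOL-Analysis.Analysis"
begin

text \<open>The class C^n on the whole space, without reference to coordinates: all directions \<open>v\<close>
  are allowed, and taking \<open>v\<close> in the standard basis gives the partial derivatives.\<close>

primrec Ck :: "nat \<Rightarrow> ('a::euclidean_space \<Rightarrow> real) \<Rightarrow> bool" where
  "Ck 0 f \<longleftrightarrow> continuous_on UNIV f"
| "Ck (Suc n) f \<longleftrightarrow> (\<forall>x. f differentiable (at x)) \<and>
     (\<forall>v. Ck n (\<lambda>x. frechet_derivative f (at x) v))"

definition Cinf :: "('a::euclidean_space \<Rightarrow> real) \<Rightarrow> bool" where
  "Cinf f \<longleftrightarrow> (\<forall>n. Ck n f)"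

definition partial2 :: "(real \<times> real \<Rightarrow> real) \<Rightarrow> real \<times> real \<Rightarrow> real" where
  "partial2 g = (\<lambda>(x, y). deriv (\<lambda>t. g (x, t)) y)"

end

theory Submission
  imports Defs
begin

text \<open>By the fundamental theorem of calculus \<open>f\<close> is a second antiderivative of
  \<open>t \<mapsto> \<partial>\<^sub>2\<^sup>2g(t, 0) / 2\<close>. The two derivatives that are lost in passing from \<open>g\<close> to
  \<open>\<partial>\<^sub>2\<^sup>2g\<close> are therefore regained by integrating twice.\<close>

lemma Ck_imp_continuous: "Ck n f \<Longrightarrow> continuous_on UNIV f"
  by (cases n) (auto intro!: continuous_at_imp_continuous_on differentiable_imp_continuous_within)

text \<open>The recursion only lowers the order by passing to directional derivatives, so
  \<open>f\<close> varies in the induction; at the bottom, differentiability yields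
  continuity.\<close>

lemma Ck_SucD: "Ck (Suc n) f \<Longrightarrow> Ck n f"
proof (induction n arbitrary: f)
  case 0
  show ?case using Ck_imp_continuous[OF 0] by simp
next
  case (Suc n)
  then show ?case by (subst Ck.simps(2)) (subst (asm) Ck.simps(2), blast)
qed

lemma Ck_cmult: "Ck n f \<Longrightarrow> Ck n (\<lambda>x. c * f x)"
proof (induction n arbitrary: f)
  case 0
  then show ?case by (auto intro: continuous_intros)
next
  case (Suc n)
  then have d: "f differentiable (at x)" for x by simp
  have "frechet_derivative (\<lambda>x. c * f x) (at x) = (\<lambda>v. c * frechet_derivative f (at x) v)" for x
    using has_derivative_mult_right[OF frechet_derivative_works[THEN iffD1, OF d[of x]], of c]
    by (rule frechet_derivative_at[symmetric])
  then show ?case using Suc d by simp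
qed

text \<open>By the chain rule, the derivative in direction \<open>v\<close> is the derivative of
  \<open>f\<close> in the fixed direction \<open>L v\<close>, again composed with \<open>L\<close>,
  so the induction closes. It serves to restrict a function of two variables to the first
  axis.\<close>

lemma Ck_compose_linear:
  fixes L :: "'a::euclidean_space \<Rightarrow> 'b::euclidean_space"
  assumes L: "bounded_linear L"
  shows "Ck n f \<Longrightarrow> Ck n (\<lambda>x. f (L x))"
proof (induction n arbitrary: f)
  case 0
  then show ?case
    using linear_continuous_on[OF L] by (auto intro: continuous_on_compose2)
next
  case (Suc n)
  then have d: "f differentiable (at x)" for x by simp
  have D: "((\<lambda>x. f (L x)) has_derivative (\<lambda>v. frechet_derivative f (at (L x)) (L v))) (at x)" for x
    by (rule has_derivative_compose[OF bounded_linear_imp_has_derivative[OF L]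
          frechet_derivative_works[THEN iffD1, OF d]])
  then have "frechet_derivative (\<lambda>x. f (L x)) (at x) = (\<lambda>v. frechet_derivative f (at (L x)) (L v))" for x
    by (rule frechet_derivative_at[symmetric])
  moreover have "Ck n (\<lambda>x. frechet_derivative f (at (L x)) (L v))" for v
    using Suc.prems by (intro Suc.IH) simp
  ultimately show ?case using D by (auto simp: differentiable_def)
qed

text \<open>On the line the derivative in direction \<open>v\<close> is the constant multiple
  \<open>v * f' x\<close>, so all directional derivatives inherit the class of
  \<open>f'\<close>.\<close>

lemma Ck_antiderivative:
  fixes f :: "real \<Rightarrow> real"
  assumes "\<And>x. (f has_real_derivative f' x) (at x)" and "Ck n f'"
  shows "Ck (Suc n) f"
proof -
  have "frechet_derivative f (at x) = (\<lambda>v. v * f' x)" for x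
    using assms(1)[of x] frechet_derivative_at
    by (metis has_field_derivative_def mult_commute_abs)
  then show ?thesis
    using assms Ck_cmult[OF assms(2)] by (auto simp: real_differentiable_def)
qed

text \<open>The partial derivative is the Frechet derivative in direction \<open>(0, 1)\<close>, one
  of the directional derivatives that \<open>Ck (Suc n) g\<close> places in class
  \<open>n\<close>.\<close>

lemma Ck_partial2:
  assumes "Ck (Suc n) g"
  shows "Ck n (partial2 g)"
proof -
  have "partial2 g p = frechet_derivative g (at p) (0, 1)" for p
  proof (cases p)
    case (Pair x y)
    have g: "(g has_derivative frechet_derivative g (at (x, y))) (at (x, y))"
      using assms by (simp add: frechet_derivative_works[symmetric])
    have "((\<lambda>t. (x, t)) has_derivative (\<lambda>v. (0, v))) (at y)"
      by (auto intro!: derivative_eq_intros)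
    from has_derivative_compose[OF this g]
    have "((\<lambda>t. g (x, t)) has_derivative (\<lambda>v. frechet_derivative g (at (x, y)) (0, v))) (at y)" .
    moreover have "(\<lambda>v. frechet_derivative g (at (x, y)) (0, v))
        = (*) (frechet_derivative g (at (x, y)) (0, 1))"
    proof
      fix v
      show "frechet_derivative g (at (x, y)) (0, v) = frechet_derivative g (at (x, y)) (0, 1) * v"
        using linear_scale[OF has_derivative_linear[OF g], of v "(0, 1)"] by simp
    qed
    ultimately have "((\<lambda>t. g (x, t)) has_real_derivative frechet_derivative g (at (x, y)) (0, 1)) (at y)"
      by (simp add: has_field_derivative_def)
    then show ?thesis by (simp add: Pair partial2_def DERIV_imp_deriv)
  qed
  then have "partial2 g = (\<lambda>p. frechet_derivative g (at p) (0, 1))" by blast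
  then show ?thesis using assms by simp
qed

lemma real_polynomial_function_partial2:
  assumes "real_polynomial_function g"
  shows "real_polynomial_function (partial2 g)"
proof -
  \<comment> \<open>Since \<open>deriv\<close> is total, the induction carries an actual derivative
    \<open>g'\<close>; the sum and product rules need differentiability, not just a value of
    \<open>deriv\<close>.\<close>
  from assms have "\<exists>g'. real_polynomial_function g' \<and>
      (\<forall>x y. ((\<lambda>t. g (x, t)) has_real_derivative g' (x, y)) (at y))"
  proof (induction rule: real_polynomial_function.induct)
    case (linear g)
    have g: "g (x, t) = g (x, 0) + g (0, 1) * t" for x t
      using linear_add[OF bounded_linear.linear[OF linear], of "(x, 0)" "(0, t)"]
        linear_scale[OF bounded_linear.linear[OF linear], of t "(0, 1)"] by simp
    have "((\<lambda>t. g (x, t)) has_real_derivative g (0, 1)) (at y)" for x y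
      by (subst g) (auto intro!: derivative_eq_intros)
    then show ?case by (intro exI[of _ "\<lambda>_. g (0, 1)"]) auto
  next
    case (const c)
    show ?case by (intro exI[of _ "\<lambda>_. 0"]) auto
  next
    case (add g h)
    then obtain g' h' where "real_polynomial_function g'" "real_polynomial_function h'"
      and "\<And>x y. ((\<lambda>t. g (x, t)) has_real_derivative g' (x, y)) (at y)"
      and "\<And>x y. ((\<lambda>t. h (x, t)) has_real_derivative h' (x, y)) (at y)"
      by blast
    then show ?case
      by (intro exI[of _ "\<lambda>p. g' p + h' p"]) (auto intro!: derivative_eq_intros)
  next
    case (mult g h)
    then obtain g' h' where "real_polynomial_function g'" "real_polynomial_function h'"
      and "\<And>x y. ((\<lambda>t. g (x, t)) has_real_derivative g' (x, y)) (at y)"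
      and "\<And>x y. ((\<lambda>t. h (x, t)) has_real_derivative h' (x, y)) (at y)"
      by blast
    \<comment> \<open>The product rule brings back \<open>g\<close> and \<open>h\<close> themselves,
      so their polynomiality is supplied again.\<close>
    then show ?case using mult
      by (intro exI[of _ "\<lambda>p. g' p * h p + h' p * g p"]) (auto intro!: derivative_eq_intros)
  qed
  then obtain g' where "real_polynomial_function g'"
    and "\<And>x y. ((\<lambda>t. g (x, t)) has_real_derivative g' (x, y)) (at y)"
    by blast
  moreover from this(2) have "partial2 g = g'"
    by (auto simp: partial2_def fun_eq_iff intro: DERIV_imp_deriv)
  ultimately show ?thesis by simp
qed

text \<open>Integrating \<open>f'\<close> term by term gives a polynomial \<open>P\<close> with the
  same derivative, and \<open>f - P\<close> is constant.\<close>

lemma real_polynomial_function_antiderivative: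
  fixes f :: "real \<Rightarrow> real"
  assumes f: "\<And>x. (f has_real_derivative f' x) (at x)" and "real_polynomial_function f'"
  shows "real_polynomial_function f"
proof -
  obtain a n where f': "f' = (\<lambda>x. \<Sum>i\<le>n. a i * x ^ i)"
    using assms(2) real_polynomial_function_iff_sum by auto
  define P where "P = (\<lambda>x::real. \<Sum>i\<le>n. a i / real (Suc i) * x ^ Suc i)"
  have "((\<lambda>x. a i / real (Suc i) * x ^ Suc i) has_real_derivative a i * x ^ i) (at x)" for i x
    using DERIV_cmult[OF DERIV_pow[of "Suc i" x], of "a i / real (Suc i)"]
    by simp
  then have "(P has_real_derivative f' x) (at x)" for x
    unfolding P_def f' by (intro DERIV_sum)
  then have "((\<lambda>x. f x - P x) has_real_derivative 0) (at x)" for x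
    using DERIV_diff[OF f] by fastforce
  then have "f x - P x = f 0 - P 0" for x
    by (intro DERIV_isconst_all) blast
  then have "f x = (f 0 - P 0) + P x" for x
    by (metis diff_add_cancel)
  then obtain c where "f = (\<lambda>x. c + P x)"
    by blast
  moreover have "real_polynomial_function P"
    unfolding P_def
    by (intro real_polynomial_function_sum real_polynomial_function.intros(4)
        real_polynomial_function_power real_polynomial_function.intros(2)
        real_polynomial_function.intros(1)[OF bounded_linear_ident]) simp
  ultimately show ?thesis
    by (simp add: real_polynomial_function.intros(2,3))
qed

lemma LBINT_has_real_derivative:
  fixes h :: "real \<Rightarrow> real"
  assumes "continuous_on UNIV h"
  shows "((\<lambda>x. LBINT t=0..x. h t) has_real_derivative h x) (at x)"
proof -
  \<comment> \<open>This choice puts 0 and \<open>x\<close> in the interior of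
    \<open>{-b..b}\<close>, so the derivative within the interval is a two-sided one.\<close>
  define b where "b = \<bar>x\<bar> + 1"
  have "((\<lambda>u. LBINT t=ereal 0..u. h t) has_vector_derivative h x) (at x within {-b..b})"
    by (rule interval_integral_FTC2) (auto simp: b_def intro: continuous_on_subset[OF assms])
  moreover have "at x within {-b..b} = at x"
    by (rule at_within_interior) (auto simp: b_def)
  ultimately show ?thesis
    by (simp add: has_real_derivative_iff_has_vector_derivative zero_ereal_def)
qed

text \<open>The variable \<open>x\<close> occurs both as a limit and in the integrand. Splitting the
  kernel \<open>x - t\<close> moves it outside the integrals, leaving
  \<open>x * ?H x - ?K x\<close>, to which the product rule and the fundamental theorem
  apply.\<close>

lemma second_antiderivative:
  fixes f h :: "real \<Rightarrow> real"
  assumes h: "continuous_on UNIV h"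
    and f: "\<And>x. f x = a + b * x + c * (LBINT t=0..x. (x - t) * h t)"
  obtains f' where "\<And>x. (f has_real_derivative f' x) (at x)"
    and "\<And>x. (f' has_real_derivative c * h x) (at x)"
proof
  let ?H = "\<lambda>x::real. LBINT t=0..x. h t"
  let ?K = "\<lambda>x::real. LBINT t=0..x. t * h t"
  have k: "continuous_on UNIV (\<lambda>t. t * h t)"
    by (intro continuous_intros h)
  have int: "interval_lebesgue_integrable lborel 0 (ereal x) q"
    if "continuous_on UNIV q" for q :: "real \<Rightarrow> real" and x
    unfolding zero_ereal_def
    by (rule interval_integrable_isCont) (use that in \<open>simp add: continuous_on_eq_continuous_at\<close>)
  have "(LBINT t=0..x. (x - t) * h t) = x * ?H x - ?K x" for x :: real
  proof -
    have "(LBINT t=0..x. (x - t) * h t) = (LBINT t=0..x. x * h t - t * h t)"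
      by (simp add: algebra_simps)
    also have "\<dots> = (LBINT t=0..x. x * h t) - ?K x"
      by (intro interval_lebesgue_integral_diff int k continuous_intros h)
    finally show ?thesis by simp
  qed
  then have f_eq: "f = (\<lambda>x. a + b * x + c * (x * ?H x - ?K x))"
    using f by auto
  \<comment> \<open>The derivative of \<open>x * ?H x - ?K x\<close> is
    \<open>?H x + x * h x - x * h x\<close>; the boundary terms cancel.\<close>
  show "(f has_real_derivative b + c * ?H x) (at x)" for x
    unfolding f_eq
    by (auto intro!: derivative_eq_intros LBINT_has_real_derivative h k)
  show "((\<lambda>x. b + c * ?H x) has_real_derivative c * h x) (at x)" for x
    by (auto intro!: derivative_eq_intros LBINT_has_real_derivative h)
qed

theorem corollary3p2:
  fixes g :: "real \<times> real \<Rightarrow> real" and f :: "real \<Rightarrow> real"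
  assumes eq: "\<And>x y z :: real. g (x + y, z) + g (x - y, z) + 2 * g (x, y)
      = g (x, y + z) + g (x, y - z) + 2 * g (y, z)"
    and f: "\<And>x. f x = - (1/2) * g (0, 0) - (1/2) * partial2 g (0, 0) * x
      + (1/2) * (LBINT t=0..x. (x - t) * partial2 (partial2 g) (t, 0))"
  shows "(\<forall>k\<ge>2. Ck k g \<longrightarrow> Ck k f)
    \<and> (Cinf g \<longrightarrow> Cinf f)
    \<and> (real_polynomial_function g \<longrightarrow> real_polynomial_function f)"
proof -
  define h where "h = (\<lambda>t. partial2 (partial2 g) (t, 0))"
  have f_eq: "f x = - (1/2) * g (0, 0) + (- (1/2) * partial2 g (0, 0)) * x
      + (1/2) * (LBINT t=0..x. (x - t) * h t)" for x
    unfolding f h_def by simp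
  have L: "bounded_linear (\<lambda>t::real. (t, 0::real))"
    by (intro bounded_linear_Pair bounded_linear_ident bounded_linear_zero)
  \<comment> \<open>For \<open>n = 0\<close> the function \<open>h\<close> is merely continuous,
    which is still enough for the fundamental theorem.\<close>
  have step: "Ck (Suc (Suc n)) f" if "Ck (Suc (Suc n)) g" for n
  proof -
    have h: "Ck n h"
      unfolding h_def using that by (intro Ck_compose_linear[OF L] Ck_partial2)
    obtain f' where "\<And>x. (f has_real_derivative f' x) (at x)"
      and "\<And>x. (f' has_real_derivative (1/2) * h x) (at x)"
      using second_antiderivative[OF Ck_imp_continuous[OF h] f_eq] by blast
    then show ?thesis
      using Ck_antiderivative[of f f'] Ck_antiderivative[of f' "\<lambda>x. (1/2) * h x"]
        Ck_cmult[OF h, of "1/2"] by blast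
  qed
  have "Ck k f" if "k \<ge> 2" "Ck k g" for k
    using that step by (metis add_2_eq_Suc le_Suc_ex)
  \<comment> \<open>Orders 0 and 1, not reached by \<open>step\<close>, follow from higher ones by
    \<open>Ck_SucD\<close>.\<close>
  moreover have "Cinf f" if "Cinf g"
    using step that Ck_SucD unfolding Cinf_def by blast
  moreover have "real_polynomial_function f" if "real_polynomial_function g"
  proof -
    \<comment> \<open>The embedding of the axis is linear, hence polynomial, so \<open>h\<close> is
      a composition of polynomial maps; its continuity comes from this as well.\<close>
    have "polynomial_function (\<lambda>t::real. (t, 0::real))"
      by (rule polynomial_function_bounded_linear[OF L])
    then have h: "real_polynomial_function h"
      using real_polynomial_function_compose[of "\<lambda>t. (t, 0)" "partial2 (partial2 g)"]
        real_polynomial_function_partial2 that by (simp add: h_def o_def)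
    then have "continuous_on UNIV h"
      by (simp add: continuous_on_polymonial_function real_polynomial_function_eq)
    then obtain f' where "\<And>x. (f has_real_derivative f' x) (at x)"
      and "\<And>x. (f' has_real_derivative (1/2) * h x) (at x)"
      using second_antiderivative[OF _ f_eq] by blast
    then show ?thesis
      using real_polynomial_function_antiderivative[of f f']
        real_polynomial_function_antiderivative[of f' "\<lambda>x. (1/2) * h x"]
        real_polynomial_function.intros(4)[OF real_polynomial_function.intros(2)[of "1/2"] h]
      by blast
  qed
  ultimately show ?thesis by blast
qed

end
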